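(* For every integer $d\ge 2$ there exist constants $c_d',C_d'>0$ depending only on $d$ such that for every integer $n\ge d$ and every family of real weights $W=\{w(e)\}_{e\in E}$ on the edges of the complete $d$-homogeneous hypergraph $H_{n,d}=(V,E)$ with $n$ vertices, $$ c_d'\sum_{v\in V}\Bigl(\sum_{e\in E:\,v\in e}w(e)^2\Bigr)^{1/2}\le \mathrm{disc}(H_{n,d}(W))\le \mathsf{E}_\theta\max_{V'\subset V}\Bigl|\sum_{e\in E,\,e\subset V'}\theta(e)w(e)\Bigr|\le C_d'\sum_{v\in V}\Bigl(\sum_{e\in E:\,v\in e}w(e)^2\Bigr)^{1/2}. $$
   Context: The complete $d$-homogeneous hypergraph $H_{n,d}=(V,E)$ has a vertex set $V$ with $|V|=n$ and its edge set $E$ consists of all subsets of $V$ of cardinality $d$. The discrepancy of the edge-weighted hypergraph $H_{n,d}(W)$ is $$\mathrm{disc}(H_{n,d}(W)):=\min_{\theta}\max_{V'\subset V}\Bigl|\sum_{e\in E,\,e\subset V'}\theta(e)w(e)\Bigr|,$$ where the minimum is over all colorings $\theta:E\to\{-1,1\}$. $\mathsf{E}_\theta$ denotes the expectation (uniform average) over all colorings $\theta:E\to\{-1,1\}$. *)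

theory Defs
  imports "HOL-Analysis.Analysis"
begin

text \<open>The definitions are polymorphic in the vertex type, but a statement about constants
  depending on \<open>d\<close> only has to fix the type (to \<open>nat\<close>, say): with a type variable for the
  vertices, the constants could depend on its instance.\<close>

definition complete_edges :: "'a set \<Rightarrow> nat \<Rightarrow> 'a set set" where
  "complete_edges V d = {e. e \<subseteq> V \<and> card e = d}"

text \<open>The colorings of \<open>E\<close> are taken extensionally, so that there are exactly
  \<open>2 ^ card E\<close> of them.\<close>

definition colorings :: "'a set set \<Rightarrow> ('a set \<Rightarrow> real) set" where
  "colorings E = E \<rightarrow>\<^sub>E {-1, 1}"

definition max_imbalance :: "'a set \<Rightarrow> 'a set set \<Rightarrow> ('a set \<Rightarrow> real) \<Rightarrow> ('a set \<Rightarrow> real) \<Rightarrow> real" where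
  "max_imbalance V E w \<theta> = (MAX V'\<in>Pow V. \<bar>\<Sum>e | e \<in> E \<and> e \<subseteq> V'. \<theta> e * w e\<bar>)"

definition disc :: "'a set \<Rightarrow> 'a set set \<Rightarrow> ('a set \<Rightarrow> real) \<Rightarrow> real" where
  "disc V E w = (MIN \<theta>\<in>colorings E. max_imbalance V E w \<theta>)"

definition coloring_expectation :: "'a set set \<Rightarrow> (('a set \<Rightarrow> real) \<Rightarrow> real) \<Rightarrow> real" where
  "coloring_expectation E F = (\<Sum>\<theta>\<in>colorings E. F \<theta>) / real (card (colorings E))"

definition degree_norm_sum :: "'a set \<Rightarrow> 'a set set \<Rightarrow> ('a set \<Rightarrow> real) \<Rightarrow> real" where
  "degree_norm_sum V E w = (\<Sum>v\<in>V. sqrt (\<Sum>e | e \<in> E \<and> v \<in> e. (w e)\<^sup>2))"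

end

theory Submission
  imports Defs "HOL-Computational_Algebra.Polynomial"
begin

text \<open>
  Fix a coloring and write \<open>a e = \<theta> e * w e\<close>. The imbalance of \<open>V'\<close> is the value at the indicator
  of \<open>V'\<close> of the multilinear polynomial \<open>F(y) = \<Sum>\<^sub>e a e * \<Prod>\<^sub>v\<^sub>\<in>\<^sub>e y v\<close>. So the lower bound is about every real
  family \<open>a\<close>, and only \<open>(a e)\<^sup>2 = (w e)\<^sup>2\<close> ties it to the weights. Let \<open>\<sigma>\<^sub>v\<close> be the degree norm of \<open>v\<close>,
  the square root of \<open>\<Sum>\<^sub>e\<^sub>\<ni>\<^sub>v (w e)\<^sup>2\<close>.

  For the lower bound, suppose that \<open>\<bar>F\<bar> \<le> M\<close> on \<open>{0,1}\<^sup>V\<close>. Since \<open>F\<close> is affine in each variable, the bound holds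
  on \<open>[0,1]\<^sup>V\<close>. A real polynomial of degree at most \<open>d\<close> that is bounded on \<open>[0,1]\<close> has bounded
  coefficients. Applied to \<open>F\<close> along lines, this first extends the bound to \<open>[-1,1]\<^sup>V\<close> and then, since
  the linear coefficient of \<open>F(s + t\<tau>)\<close> is a directional derivative and \<open>\<tau>\<close> may be any sign vector,
  bounds \<open>\<Sum>\<^sub>v \<bar>\<partial>\<^sub>v F(s)\<bar>\<close> by a multiple of \<open>M\<close> for each sign vector \<open>s\<close> (\<open>edge_poly_gradient_bound\<close>).
  For random \<open>s\<close> each \<open>\<bar>\<partial>\<^sub>v F(s)\<bar>\<close> is the absolute value of a Rademacher chaos with
  coefficients \<open>a e\<close>, \<open>v \<in> e\<close>, and the Khintchine inequality for chaoses (\<open>walsh_Khintchine\<close>) says that its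
  mean is at least a multiple of \<open>\<sigma>\<^sub>v\<close>. Averaging over \<open>s\<close> gives the claim.

  For the upper bound, let \<open>U\<close> have \<open>m\<close> vertices and let \<open>T\<close> be the half of \<open>U\<close> with the largest degree norms,
  with minimum \<open>\<mu>\<close>. The edges in \<open>U\<close> that leave \<open>T\<close> have total squared weight at most \<open>m\<mu>\<^sup>2\<close>, so a union
  bound over the \<open>2\<^sup>m\<close> subsets of \<open>U\<close> shows that they contribute \<open>O(m\<mu>)\<close>. If \<open>T'\<close> is the top half of \<open>T\<close>,
  this is at most a multiple of the sum of \<open>\<sigma>\<close> over \<open>T - T'\<close>. Continue with \<open>T\<close> in place of
  \<open>U\<close>: the layers \<open>T - T'\<close> that are charged are disjoint, so the total is at most a multiple of the
  sum of all degree norms (\<open>sign_mean_max_imbalance_le_top_half\<close>). The constant is absolute.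
\<close>

section \<open>Averages over signs\<close>

text \<open>The signs are indexed by an arbitrary set, since the proofs average over different ones:
  colorings of the edges for the upper bound, sign vectors on the vertices for the lower bound.\<close>

definition sign_mean :: "'i set \<Rightarrow> (('i \<Rightarrow> real) \<Rightarrow> real) \<Rightarrow> real" where
  "sign_mean I F = (\<Sum>\<sigma>\<in>I \<rightarrow>\<^sub>E {-1, 1}. F \<sigma>) / 2 ^ card I"

lemma finite_signs: "finite I \<Longrightarrow> finite (I \<rightarrow>\<^sub>E {-1, 1::real})"
  by (intro finite_PiE) auto

lemma card_signs: "finite I \<Longrightarrow> card (I \<rightarrow>\<^sub>E {-1, 1::real}) = 2 ^ card I"
  by (simp add: card_PiE numeral_2_eq_2)

lemma sign_mean_mono:
  assumes "\<And>\<sigma>. \<sigma> \<in> I \<rightarrow>\<^sub>E {-1, 1} \<Longrightarrow> F \<sigma> \<le> G \<sigma>"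
  shows "sign_mean I F \<le> sign_mean I G"
  unfolding sign_mean_def by (intro divide_right_mono sum_mono assms) auto

lemma sign_mean_cong:
  assumes "\<And>\<sigma>. \<sigma> \<in> I \<rightarrow>\<^sub>E {-1, 1} \<Longrightarrow> F \<sigma> = G \<sigma>"
  shows "sign_mean I F = sign_mean I G"
  using assms by (simp add: sign_mean_def)

lemma sign_mean_nonneg: "(\<And>\<sigma>. F \<sigma> \<ge> 0) \<Longrightarrow> sign_mean I F \<ge> 0"
  unfolding sign_mean_def by (intro divide_nonneg_nonneg sum_nonneg) auto

lemma sign_mean_const: "finite I \<Longrightarrow> sign_mean I (\<lambda>_. c) = c"
  by (simp add: sign_mean_def card_signs)

lemma sign_mean_add: "sign_mean I (\<lambda>\<sigma>. F \<sigma> + G \<sigma>) = sign_mean I F + sign_mean I G"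
  by (simp add: sign_mean_def sum.distrib add_divide_distrib)

lemma sign_mean_diff: "sign_mean I (\<lambda>\<sigma>. F \<sigma> - G \<sigma>) = sign_mean I F - sign_mean I G"
  by (simp add: sign_mean_def sum_subtractf diff_divide_distrib)

lemma sign_mean_cmult: "sign_mean I (\<lambda>\<sigma>. c * F \<sigma>) = c * sign_mean I F"
  by (simp add: sign_mean_def sum_distrib_left)

lemma sign_mean_sum: "sign_mean I (\<lambda>\<sigma>. \<Sum>a\<in>A. F a \<sigma>) = (\<Sum>a\<in>A. sign_mean I (F a))"
  unfolding sign_mean_def sum_divide_distrib[symmetric] by (subst sum.swap) simp

lemma sign_mean_insert:
  assumes "finite V" "v \<notin> V"
  shows "sign_mean (insert v V) F =
    sign_mean V (\<lambda>\<sigma>. (F (\<sigma>(v := 1)) + F (\<sigma>(v := -1))) / 2)"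
proof -
  have "(\<Sum>\<sigma>\<in>insert v V \<rightarrow>\<^sub>E {-1, 1}. F \<sigma>)
      = (\<Sum>(y, \<sigma>)\<in>{-1, 1} \<times> (V \<rightarrow>\<^sub>E {-1, 1}). F (\<sigma>(v := y)))"
    unfolding PiE_insert_eq
    by (subst sum.reindex[OF inj_combinator[OF assms(2)]]) (simp add: case_prod_beta comp_def)
  also have "\<dots> = (\<Sum>\<sigma>\<in>V \<rightarrow>\<^sub>E {-1, 1}. F (\<sigma>(v := 1)) + F (\<sigma>(v := -1)))"
    by (simp add: sum.cartesian_product[symmetric] sum.distrib)
  finally show ?thesis
    using assms by (simp add: sign_mean_def sum_divide_distrib[symmetric])
qed

lemma sign_mean_prod:
  assumes "finite I"
  shows "sign_mean I (\<lambda>\<sigma>. \<Prod>i\<in>I. g i (\<sigma> i)) = (\<Prod>i\<in>I. (g i 1 + g i (-1)) / 2)"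
proof -
  have "(\<Sum>\<sigma>\<in>I \<rightarrow>\<^sub>E {-1, 1}. \<Prod>i\<in>I. g i (\<sigma> i)) = (\<Prod>i\<in>I. \<Sum>y\<in>{-1, 1::real}. g i y)"
    using assms by (intro prod_sum_PiE[symmetric]) auto
  then show ?thesis
    by (simp add: sign_mean_def prod_dividef add.commute)
qed

lemma sign_mean_Cauchy_Schwarz:
  "(sign_mean I (\<lambda>\<sigma>. F \<sigma> * G \<sigma>))\<^sup>2 \<le> sign_mean I (\<lambda>\<sigma>. (F \<sigma>)\<^sup>2) * sign_mean I (\<lambda>\<sigma>. (G \<sigma>)\<^sup>2)"
proof -
  have "(sign_mean I (\<lambda>\<sigma>. F \<sigma> * G \<sigma>))\<^sup>2 = (\<Sum>\<sigma>\<in>I \<rightarrow>\<^sub>E {-1, 1}. F \<sigma> * G \<sigma>)\<^sup>2 / (2 ^ card I)\<^sup>2"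
    by (simp add: sign_mean_def power_divide)
  also have "\<dots> \<le> ((\<Sum>\<sigma>\<in>I \<rightarrow>\<^sub>E {-1, 1}. (F \<sigma>)\<^sup>2) * (\<Sum>\<sigma>\<in>I \<rightarrow>\<^sub>E {-1, 1}. (G \<sigma>)\<^sup>2)) / (2 ^ card I)\<^sup>2"
    by (intro divide_right_mono Cauchy_Schwarz_ineq_sum) auto
  finally show ?thesis
    by (simp add: sign_mean_def power2_eq_square)
qed

section \<open>Moments of Walsh polynomials\<close>

text \<open>A Rademacher chaos: the polynomial in independent signs \<open>\<sigma> v\<close> whose Walsh coefficients are \<open>a\<close>.
  Summing over all subsets of \<open>V\<close>, with the degree controlled by the support of \<open>a\<close>, makes it split into
  two polynomials of the same form when a variable is added.\<close>

definition walsh :: "'a set \<Rightarrow> ('a set \<Rightarrow> real) \<Rightarrow> ('a \<Rightarrow> real) \<Rightarrow> real" where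
  "walsh V a \<sigma> = (\<Sum>e\<in>Pow V. a e * (\<Prod>v\<in>e. \<sigma> v))"

lemma sum_Pow_insert:
  assumes "finite V" "v \<notin> V"
  shows "(\<Sum>e\<in>Pow (insert v V). f e) = (\<Sum>e\<in>Pow V. f e) + (\<Sum>e\<in>Pow V. f (insert v e))"
proof -
  have "inj_on (insert v) (Pow V)"
    using assms(2) by (intro inj_onI) (metis PowD insert_ident subsetD)
  moreover have "Pow V \<inter> insert v ` Pow V = {}"
    using assms(2) by auto
  ultimately show ?thesis
    using assms(1) by (simp add: Pow_insert sum.union_disjoint sum.reindex comp_def)
qed

lemma walsh_insert:
  assumes "finite V" "v \<notin> V"
  shows "walsh (insert v V) a (\<sigma>(v := y)) = walsh V a \<sigma> + y * walsh V (\<lambda>e. a (insert v e)) \<sigma>"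
proof -
  have 1: "(\<Prod>u\<in>e. (\<sigma>(v := y)) u) = (\<Prod>u\<in>e. \<sigma> u)" if "e \<in> Pow V" for e
    using that assms(2) by (intro prod.cong) auto
  have 2: "(\<Prod>u\<in>insert v e. (\<sigma>(v := y)) u) = y * (\<Prod>u\<in>e. \<sigma> u)" if "e \<in> Pow V" for e
  proof -
    have "finite e" "v \<notin> e"
      using that assms finite_subset by auto
    then show ?thesis
      using 1[OF that] by simp
  qed
  show ?thesis
    unfolding walsh_def sum_Pow_insert[OF assms] sum_distrib_left
    by (intro arg_cong2[where f="(+)"] sum.cong refl)
       (simp_all only: 1 2 mult.left_commute)
qed

text \<open>Parseval's identity: if \<open>g\<close> and \<open>h\<close> do not depend on the sign \<open>s\<close>, then the average of
  \<open>(g + s h)\<^sup>2\<close> over \<open>s\<close> is \<open>g\<^sup>2 + h\<^sup>2\<close>.\<close>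

lemma walsh_second_moment:
  assumes "finite V"
  shows "sign_mean V (\<lambda>\<sigma>. (walsh V a \<sigma>)\<^sup>2) = (\<Sum>e\<in>Pow V. (a e)\<^sup>2)"
  using assms
proof (induction V arbitrary: a)
  case empty
  then show ?case by (simp add: sign_mean_def walsh_def)
next
  case (insert v V)
  let ?b = "\<lambda>e. a (insert v e)"
  have "sign_mean (insert v V) (\<lambda>\<sigma>. (walsh (insert v V) a \<sigma>)\<^sup>2)
      = sign_mean V (\<lambda>\<sigma>. (walsh V a \<sigma>)\<^sup>2 + (walsh V ?b \<sigma>)\<^sup>2)"
    unfolding sign_mean_insert[OF insert.hyps] walsh_insert[OF insert.hyps]
    by (intro sign_mean_cong) (simp add: power2_eq_square field_simps)
  then show ?case
    by (simp add: sign_mean_add insert.IH sum_Pow_insert[OF insert.hyps])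
qed

text \<open>Bonami's hypercontractive estimate, by induction on the number of variables. The average of
  \<open>(g + s h)\<^sup>4\<close> over the new sign \<open>s\<close> is \<open>g\<^sup>4 + 6 g\<^sup>2 h\<^sup>2 + h\<^sup>4\<close>; here \<open>h\<close> has degree at most
  \<open>k - 1\<close>, and the factor 9 gained by this absorbs the coefficient 6 of the mixed term, which the
  Cauchy--Schwarz inequality reduces to the two pure ones.\<close>

lemma walsh_fourth_moment:
  assumes "finite V" "\<And>e. e \<subseteq> V \<Longrightarrow> card e > k \<Longrightarrow> a e = 0"
  shows "sign_mean V (\<lambda>\<sigma>. (walsh V a \<sigma>) ^ 4) \<le> 9 ^ k * (\<Sum>e\<in>Pow V. (a e)\<^sup>2)\<^sup>2"
  using assms
proof (induction V arbitrary: a k)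
  case empty
  have "1 * (a {}) ^ 4 \<le> 9 ^ k * (a {}) ^ 4"
    by (intro mult_right_mono) auto
  then show ?case by (simp add: sign_mean_def walsh_def power_mult[symmetric])
next
  case (insert v V)
  let ?b = "\<lambda>e. a (insert v e)"
  let ?g = "walsh V a" and ?h = "walsh V ?b"
  define G where "G = (\<Sum>e\<in>Pow V. (a e)\<^sup>2)"
  define H where "H = (\<Sum>e\<in>Pow V. (?b e)\<^sup>2)"
  have GH: "G \<ge> 0" "H \<ge> 0"
    unfolding G_def H_def by (auto intro: sum_nonneg)
  have card_insert: "card (insert v e) = Suc (card e)" if "e \<subseteq> V" for e
    using that insert.hyps finite_subset by (subst card_insert_disjoint) auto
  have g4: "sign_mean V (\<lambda>\<sigma>. ?g \<sigma> ^ 4) \<le> 9 ^ k * G\<^sup>2"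
    unfolding G_def using insert.prems by (intro insert.IH) auto
  have split: "sign_mean (insert v V) (\<lambda>\<sigma>. (walsh (insert v V) a \<sigma>) ^ 4)
      = sign_mean V (\<lambda>\<sigma>. ?g \<sigma> ^ 4) + 6 * sign_mean V (\<lambda>\<sigma>. (?g \<sigma>)\<^sup>2 * (?h \<sigma>)\<^sup>2)
        + sign_mean V (\<lambda>\<sigma>. ?h \<sigma> ^ 4)"
    unfolding sign_mean_insert[OF insert.hyps] walsh_insert[OF insert.hyps]
      sign_mean_cmult[symmetric] sign_mean_add[symmetric]
    by (intro sign_mean_cong) (simp add: power2_eq_square power4_eq_xxxx field_simps)
  have "sign_mean (insert v V) (\<lambda>\<sigma>. (walsh (insert v V) a \<sigma>) ^ 4) \<le> 9 ^ k * (G + H)\<^sup>2"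
  proof (cases k)
    \<comment> \<open>In degree 0 the polynomial is constant, so it does not involve the new variable.\<close>
    case 0
    have "?b e = 0" if "e \<in> Pow V" for e
      using that insert.prems[of "insert v e"] card_insert[of e] 0 by auto
    then have "?h \<sigma> = 0" for \<sigma>
      by (simp add: walsh_def)
    then have "sign_mean (insert v V) (\<lambda>\<sigma>. (walsh (insert v V) a \<sigma>) ^ 4) \<le> 9 ^ k * G\<^sup>2"
      using g4 by (simp add: split sign_mean_const[OF insert.hyps(1)])
    also have "\<dots> \<le> 9 ^ k * (G + H)\<^sup>2"
      using GH by (intro mult_left_mono power_mono) auto
    finally show ?thesis .
  next
    case (Suc j)
    have h4: "sign_mean V (\<lambda>\<sigma>. ?h \<sigma> ^ 4) \<le> 9 ^ j * H\<^sup>2"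
      unfolding H_def
    proof (rule insert.IH)
      fix e assume e: "e \<subseteq> V" "j < card e"
      then have "insert v e \<subseteq> insert v V" "k < card (insert v e)"
        using card_insert Suc by auto
      then show "a (insert v e) = 0"
        by (rule insert.prems)
    qed
    have "(sign_mean V (\<lambda>\<sigma>. (?g \<sigma>)\<^sup>2 * (?h \<sigma>)\<^sup>2))\<^sup>2
        \<le> sign_mean V (\<lambda>\<sigma>. ?g \<sigma> ^ 4) * sign_mean V (\<lambda>\<sigma>. ?h \<sigma> ^ 4)"
      using sign_mean_Cauchy_Schwarz[of V "\<lambda>\<sigma>. (?g \<sigma>)\<^sup>2" "\<lambda>\<sigma>. (?h \<sigma>)\<^sup>2"]
      by (simp add: power_mult[symmetric])
    also have "\<dots> \<le> (9 ^ k * G\<^sup>2) * (9 ^ j * H\<^sup>2)"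
      by (intro mult_mono g4 h4 sign_mean_nonneg) auto
    also have "\<dots> = (3 * 9 ^ j * G * H)\<^sup>2"
      by (simp add: Suc power_mult_distrib power2_eq_square)
    finally have "sign_mean V (\<lambda>\<sigma>. (?g \<sigma>)\<^sup>2 * (?h \<sigma>)\<^sup>2) \<le> 3 * 9 ^ j * G * H"
      by (rule power2_le_imp_le) (use GH in auto)
    then have "sign_mean (insert v V) (\<lambda>\<sigma>. (walsh (insert v V) a \<sigma>) ^ 4)
        \<le> 9 ^ k * G\<^sup>2 + 6 * (3 * 9 ^ j * G * H) + 9 ^ j * H\<^sup>2"
      unfolding split by (intro add_mono mult_left_mono g4 h4) auto
    also have "\<dots> \<le> 9 ^ k * G\<^sup>2 + 6 * (3 * 9 ^ j * G * H) + 9 ^ k * H\<^sup>2"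
      by (intro add_left_mono mult_right_mono) (auto simp: Suc)
    also have "\<dots> = 9 ^ k * (G + H)\<^sup>2"
      by (simp add: Suc power2_eq_square algebra_simps)
    finally show ?thesis .
  qed
  then show ?case
    by (simp add: G_def H_def sum_Pow_insert[OF insert.hyps])
qed

text \<open>Turns bounds on the second and fourth moments into a lower bound on the first one, without
  Hoelder's inequality. After scaling to \<open>y = \<bar>x\<bar> / s\<close> it says that \<open>y\<^sup>3 - 4 y + 4 \<ge> 0\<close> for
  \<open>y \<ge> 0\<close>.\<close>

lemma abs_ge_quadratic_minus_quartic:
  fixes x s :: real
  assumes "s > 0"
  shows "\<bar>x\<bar> \<ge> x\<^sup>2 / s - x ^ 4 / (4 * s ^ 3)"
proof -
  define y where "y = \<bar>x\<bar> / s"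
  have y: "y \<ge> 0" using assms by (simp add: y_def)
  have "4 - 4 * y + y ^ 3 = (y - 1)\<^sup>2 * (y + 2) + (2 - y)" by algebra
  have "y ^ 3 - 4 * y + 4 \<ge> 0"
  proof (cases "y \<le> 2")
    case True
    then show ?thesis
      using y \<open>4 - 4 * y + y ^ 3 = (y - 1)\<^sup>2 * (y + 2) + (2 - y)\<close>
      by (smt (verit) mult_nonneg_nonneg zero_le_power2)
  next
    case False
    have "y ^ 3 - 4 * y = y * (y - 2) * (y + 2)" by algebra
    then show ?thesis using False by (smt (verit) mult_nonneg_nonneg)
  qed
  then have "y * (y ^ 3 - 4 * y + 4) \<ge> 0"
    using y by simp
  then have "y\<^sup>2 - y ^ 4 / 4 \<le> y"
    by (simp add: algebra_simps power2_eq_square power3_eq_cube power4_eq_xxxx)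
  then have "s * (y\<^sup>2 - y ^ 4 / 4) \<le> s * y"
    using assms by (intro mult_left_mono) auto
  moreover have "s * y = \<bar>x\<bar>" "s * (y\<^sup>2 - y ^ 4 / 4) = x\<^sup>2 / s - x ^ 4 / (4 * s ^ 3)"
    using assms by (auto simp: y_def power_divide field_simps power2_eq_square power3_eq_cube power4_eq_xxxx)
  ultimately show ?thesis by simp
qed

text \<open>The Khintchine inequality for a Rademacher chaos of degree at most \<open>k\<close>: a random variable whose
  fourth moment is at most \<open>9\<^sup>k\<close> times the square of its second moment cannot have a small first
  moment.\<close>

lemma walsh_Khintchine:
  assumes "finite V" "\<And>e. e \<subseteq> V \<Longrightarrow> card e > k \<Longrightarrow> a e = 0"
  shows "3 / 4 / 3 ^ k * sqrt (\<Sum>e\<in>Pow V. (a e)\<^sup>2) \<le> sign_mean V (\<lambda>\<sigma>. \<bar>walsh V a \<sigma>\<bar>)"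
proof -
  define m where "m = sqrt (\<Sum>e\<in>Pow V. (a e)\<^sup>2)"
  have m2: "(\<Sum>e\<in>Pow V. (a e)\<^sup>2) = m\<^sup>2"
    unfolding m_def by (simp add: sum_nonneg)
  have "m \<ge> 0"
    unfolding m_def by (simp add: sum_nonneg)
  show ?thesis
  proof (cases "m = 0")
    case True
    then show ?thesis
      by (simp add: m_def[symmetric] sign_mean_nonneg)
  next
    case False
    \<comment> \<open>At this scale the quartic correction costs exactly a quarter of the quadratic main term.\<close>
    define s where "s = 3 ^ k * m"
    have s: "s > 0" using False \<open>m \<ge> 0\<close> by (simp add: s_def)
    have nine: "(9::real) ^ k = (3 ^ k)\<^sup>2"
      by (simp add: power_even_eq[symmetric] power_mult)
    have "3 / 4 / 3 ^ k * m = m\<^sup>2 / s - (9 ^ k * (m\<^sup>2)\<^sup>2) / (4 * s ^ 3)"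
      using False unfolding s_def nine
      by (simp add: field_simps power2_eq_square power3_eq_cube)
    also have "\<dots> \<le> sign_mean V (\<lambda>\<sigma>. (walsh V a \<sigma>)\<^sup>2) / s - sign_mean V (\<lambda>\<sigma>. (walsh V a \<sigma>) ^ 4) / (4 * s ^ 3)"
      using walsh_fourth_moment[of V k a] assms s
      by (intro diff_mono divide_right_mono) (auto simp: walsh_second_moment m2)
    also have "\<dots> = sign_mean V (\<lambda>\<sigma>. (walsh V a \<sigma>)\<^sup>2 / s - (walsh V a \<sigma>) ^ 4 / (4 * s ^ 3))"
      using sign_mean_cmult[of V "1/s" "\<lambda>\<sigma>. (walsh V a \<sigma>)\<^sup>2"]
        sign_mean_cmult[of V "1/(4 * s^3)" "\<lambda>\<sigma>. (walsh V a \<sigma>)^4"]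
      by (simp add: sign_mean_diff)
    also have "\<dots> \<le> sign_mean V (\<lambda>\<sigma>. \<bar>walsh V a \<sigma>\<bar>)"
      by (intro sign_mean_mono abs_ge_quadratic_minus_quartic s)
    finally show ?thesis
      by (simp add: m_def)
  qed
qed

section \<open>Degree norms\<close>

definition degree_norm :: "'a set set \<Rightarrow> ('a set \<Rightarrow> real) \<Rightarrow> 'a \<Rightarrow> real" where
  "degree_norm E w v = sqrt (\<Sum>e | e \<in> E \<and> v \<in> e. (w e)\<^sup>2)"

lemma degree_norm_nonneg: "degree_norm E w v \<ge> 0"
  by (simp add: degree_norm_def sum_nonneg)

lemma degree_norm_square: "(degree_norm E w v)\<^sup>2 = (\<Sum>e | e \<in> E \<and> v \<in> e. (w e)\<^sup>2)"
  by (simp add: degree_norm_def sum_nonneg)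

section \<open>Polynomials bounded on the unit interval\<close>

text \<open>All norms on the polynomials of degree at most \<open>d\<close> are equivalent. The induction on the degree is
  elementary: \<open>p(t) - 2\<^sup>d p(t/2)\<close> has no term of degree \<open>d\<close>, is still bounded on the unit interval, and
  its other coefficients are those of \<open>p\<close> times factors of modulus at least 1.\<close>

lemma coeff_bound_from_unit_interval:
  "\<exists>K>0. \<forall>(c :: nat \<Rightarrow> real) M. (\<forall>t\<in>{0..1}. \<bar>\<Sum>k\<le>d. c k * t ^ k\<bar> \<le> M) \<longrightarrow> (\<forall>k\<le>d. \<bar>c k\<bar> \<le> K * M)"
proof (induction d)
  case 0
  show ?case by (intro exI[of _ 1]) auto
next
  case (Suc d)
  then obtain K where K: "K > 0"
    "\<And>(c :: nat \<Rightarrow> real) M k. (\<forall>t\<in>{0..1}. \<bar>\<Sum>k\<le>d. c k * t ^ k\<bar> \<le> M) \<Longrightarrow> k \<le> d \<Longrightarrow> \<bar>c k\<bar> \<le> K * M"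
    by blast
  define B where "B = K * (1 + 2 ^ Suc d)"
  have "B > 0" using K(1) by (simp add: B_def add_pos_pos)
  show ?case
  proof (intro exI[of _ "1 + Suc d * B"] conjI allI impI)
    show "1 + Suc d * B > 0" using \<open>B > 0\<close> by (simp add: add_pos_pos)
  next
    fix c :: "nat \<Rightarrow> real" and M k
    assume M: "\<forall>t\<in>{0..1}. \<bar>\<Sum>k\<le>Suc d. c k * t ^ k\<bar> \<le> M" and k: "k \<le> Suc d"
    define p where "p t = (\<Sum>k\<le>Suc d. c k * t ^ k)" for t
    have "M \<ge> 0" using M[rule_format, of 0] by simp
    \<comment> \<open>The coefficients of \<open>p(t) - 2\<^sup>d\<^sup>+\<^sup>1 p(t/2)\<close>.\<close>
    define b where "b k = c k * (1 - 2 ^ Suc d / 2 ^ k)" for k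
    have b_bound: "\<bar>\<Sum>k\<le>d. b k * t ^ k\<bar> \<le> (1 + 2 ^ Suc d) * M" if "t \<in> {0..1}" for t
    proof -
      have "(\<Sum>k\<le>d. b k * t ^ k) = (\<Sum>k\<le>Suc d. b k * t ^ k)"
        by (simp add: b_def)
      also have "\<dots> = p t - 2 ^ Suc d * p (t / 2)"
        unfolding p_def b_def sum_distrib_left sum_subtractf[symmetric]
        by (intro sum.cong refl) (simp add: power_divide algebra_simps)
      finally have "\<bar>\<Sum>k\<le>d. b k * t ^ k\<bar> \<le> \<bar>p t\<bar> + 2 ^ Suc d * \<bar>p (t / 2)\<bar>"
        using abs_triangle_ineq4[of "p t" "2 ^ Suc d * p (t / 2)"]
        by (simp only: abs_mult power_abs abs_numeral)
      also have "\<dots> \<le> M + 2 ^ Suc d * M"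
        using M that unfolding p_def[symmetric] by (intro add_mono mult_left_mono) auto
      finally show ?thesis by (simp add: algebra_simps)
    qed
    have small: "\<bar>c k\<bar> \<le> B * M" if "k \<le> d" for k
    proof -
      have "(2::real) ^ Suc d = 2 ^ (Suc d - k) * 2 ^ k"
        using that by (simp add: power_add[symmetric])
      moreover have "(2::real) ^ 1 \<le> 2 ^ (Suc d - k)"
        using that by (intro power_increasing) auto
      ultimately have "\<bar>1 - 2 ^ Suc d / 2 ^ k\<bar> \<ge> (1::real)" by simp
      then have "\<bar>c k\<bar> \<le> \<bar>b k\<bar>"
        unfolding b_def abs_mult by (metis abs_ge_zero mult.right_neutral mult_left_mono)
      also have "\<bar>b k\<bar> \<le> K * ((1 + 2 ^ Suc d) * M)"
        by (rule K(2)) (use b_bound that in auto)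
      finally show ?thesis by (simp add: B_def mult_ac)
    qed
    show "\<bar>c k\<bar> \<le> (1 + Suc d * B) * M"
    proof (cases "k \<le> d")
      case True
      have "B * M \<le> (1 + Suc d * B) * M"
        using \<open>B > 0\<close> \<open>M \<ge> 0\<close> by (intro mult_right_mono) (auto simp: algebra_simps)
      then show ?thesis using small[OF True] by linarith
    next
      case False
      then have "k = Suc d" using k by simp
      have "c (Suc d) = p 1 - (\<Sum>k\<le>d. c k)"
        by (simp add: p_def)
      then have "\<bar>c (Suc d)\<bar> \<le> \<bar>p 1\<bar> + (\<Sum>k\<le>d. \<bar>c k\<bar>)"
        using sum_abs[of c "{..d}"] by linarith
      also have "\<dots> \<le> M + (\<Sum>k\<le>d. B * M)"
        using M[rule_format, of 1] small by (intro add_mono sum_mono) (auto simp: p_def)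
      finally show ?thesis
        using \<open>k = Suc d\<close> by (simp add: algebra_simps)
    qed
  qed
qed

lemma poly_coeff_bound_from_unit_interval:
  "\<exists>K>0. \<forall>(p :: real poly) M. degree p \<le> d \<longrightarrow> (\<forall>t\<in>{0..1}. \<bar>poly p t\<bar> \<le> M) \<longrightarrow> (\<forall>k. \<bar>coeff p k\<bar> \<le> K * M)"
proof -
  obtain K where K: "K > 0"
    "\<And>(c :: nat \<Rightarrow> real) M k. (\<forall>t\<in>{0..1}. \<bar>\<Sum>k\<le>d. c k * t ^ k\<bar> \<le> M) \<Longrightarrow> k \<le> d \<Longrightarrow> \<bar>c k\<bar> \<le> K * M"
    using coeff_bound_from_unit_interval[of d] by blast
  show ?thesis
  proof (intro exI[of _ K] conjI allI impI K(1))
    fix p :: "real poly" and M k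
    assume deg: "degree p \<le> d" and M: "\<forall>t\<in>{0..1}. \<bar>poly p t\<bar> \<le> M"
    have "poly p t = (\<Sum>k\<le>d. coeff p k * t ^ k)" for t
      unfolding poly_altdef using deg
      by (intro sum.mono_neutral_left) (auto simp: coeff_eq_0)
    then have *: "\<bar>coeff p k\<bar> \<le> K * M" if "k \<le> d" for k
      using M that by (intro K(2)) auto
    show "\<bar>coeff p k\<bar> \<le> K * M"
    proof (cases "k \<le> d")
      case False
      then show ?thesis
        using deg *[of 0] by (simp add: coeff_eq_0)
    qed (rule *)
  qed
qed

section \<open>The multilinear polynomial of a weighted hypergraph\<close>

definition edge_poly :: "'a set set \<Rightarrow> ('a set \<Rightarrow> real) \<Rightarrow> ('a \<Rightarrow> real) \<Rightarrow> real" where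
  "edge_poly E a y = (\<Sum>e\<in>E. a e * (\<Prod>v\<in>e. y v))"

definition edge_poly_deriv :: "'a set set \<Rightarrow> ('a set \<Rightarrow> real) \<Rightarrow> 'a \<Rightarrow> ('a \<Rightarrow> real) \<Rightarrow> real" where
  "edge_poly_deriv E a v y = (\<Sum>e | e \<in> E \<and> v \<in> e. a e * (\<Prod>u\<in>e - {v}. y u))"

definition edge_poly_line ::
  "'a set set \<Rightarrow> ('a set \<Rightarrow> real) \<Rightarrow> ('a \<Rightarrow> real) \<Rightarrow> ('a \<Rightarrow> real) \<Rightarrow> real poly" where
  "edge_poly_line E a y z = (\<Sum>e\<in>E. smult (a e) (\<Prod>v\<in>e. [:y v, z v:]))"

lemma poly_edge_poly_line: "poly (edge_poly_line E a y z) t = edge_poly E a (\<lambda>v. y v + t * z v)"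
  by (simp add: edge_poly_line_def edge_poly_def poly_sum poly_prod)

lemma degree_edge_poly_line:
  assumes "finite E" "\<And>e. e \<in> E \<Longrightarrow> finite e" "\<And>e. e \<in> E \<Longrightarrow> card e \<le> d"
  shows "degree (edge_poly_line E a y z) \<le> d"
  unfolding edge_poly_line_def
proof (rule degree_sum_le[OF assms(1)])
  fix e assume e: "e \<in> E"
  have "degree (smult (a e) (\<Prod>v\<in>e. [:y v, z v:])) \<le> degree (\<Prod>v\<in>e. [:y v, z v:])"
    by (rule degree_smult_le)
  also have "\<dots> \<le> (\<Sum>v\<in>e. degree [:y v, z v:])"
    using degree_prod_sum_le[OF assms(2)[OF e], of "\<lambda>v. [:y v, z v:]"] by (simp add: comp_def)
  also have "\<dots> \<le> (\<Sum>v\<in>e. 1)"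
    by (intro sum_mono) simp
  also have "\<dots> \<le> d" using assms(3)[OF e] by simp
  finally show "degree (smult (a e) (\<Prod>v\<in>e. [:y v, z v:])) \<le> d" .
qed

text \<open>The derivative at \<open>t = 0\<close> of the polynomial on the line \<open>y + t z\<close>, by the chain rule.\<close>

lemma coeff_1_edge_poly_line:
  assumes "finite E" "finite V" "\<And>e. e \<in> E \<Longrightarrow> e \<subseteq> V"
  shows "coeff (edge_poly_line E a y z) 1 = (\<Sum>v\<in>V. z v * edge_poly_deriv E a v y)"
proof -
  have "coeff (\<Prod>v\<in>e. [:y v, z v:]) 1 = poly (pderiv (\<Prod>v\<in>e. [:y v, z v:])) 0" for e
    by (simp add: poly_0_coeff_0 coeff_pderiv)
  also have "\<dots> e = (\<Sum>v\<in>e. (\<Prod>u\<in>e - {v}. y u) * z v)" for e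
    by (simp add: pderiv_prod poly_sum poly_prod pderiv_pCons mult.commute)
  finally have "coeff (edge_poly_line E a y z) 1
      = (\<Sum>e\<in>E. a e * (\<Sum>v\<in>e. (\<Prod>u\<in>e - {v}. y u) * z v))"
    by (simp add: edge_poly_line_def coeff_sum)
  also have "\<dots> = (\<Sum>e\<in>E. \<Sum>v\<in>V. if v \<in> e then z v * (a e * (\<Prod>u\<in>e - {v}. y u)) else 0)"
  proof (rule sum.cong[OF refl])
    fix e assume "e \<in> E"
    then have "{v \<in> V. v \<in> e} = e" using assms(3) by auto
    then show "a e * (\<Sum>v\<in>e. (\<Prod>u\<in>e - {v}. y u) * z v) =
        (\<Sum>v\<in>V. if v \<in> e then z v * (a e * (\<Prod>u\<in>e - {v}. y u)) else 0)"
      unfolding sum.inter_filter[OF assms(2), symmetric]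
      by (simp add: sum_distrib_left mult_ac)
  qed
  also have "\<dots> = (\<Sum>v\<in>V. z v * edge_poly_deriv E a v y)"
    unfolding edge_poly_deriv_def sum.inter_filter[OF assms(1)] sum_distrib_left
    by (subst sum.swap) (intro sum.cong refl, simp)
  finally show ?thesis .
qed

lemma edge_poly_indicator:
  assumes "finite E" "\<And>e. e \<in> E \<Longrightarrow> finite e"
  shows "edge_poly E a (indicator S) = (\<Sum>e | e \<in> E \<and> e \<subseteq> S. a e)"
  unfolding edge_poly_def sum.inter_filter[OF assms(1)]
proof (rule sum.cong[OF refl])
  fix e assume "e \<in> E"
  then have "finite e" by (rule assms(2))
  then show "a e * (\<Prod>v\<in>e. indicator S v) = (if e \<subseteq> S then a e else 0)"
  proof (cases "e \<subseteq> S")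
    case False
    then obtain v where "v \<in> e" "v \<notin> S" by auto
    then have "(\<Prod>v\<in>e. indicator S v :: real) = 0"
      using \<open>finite e\<close> by (intro prod_zero bexI[of _ v]) auto
    then show ?thesis using False by simp
  qed (auto simp: indicator_def subset_iff intro!: prod.neutral)
qed

lemma edge_poly_cong:
  assumes "\<And>e. e \<in> E \<Longrightarrow> e \<subseteq> V" "\<And>v. v \<in> V \<Longrightarrow> y v = y' v"
  shows "edge_poly E a y = edge_poly E a y'"
  unfolding edge_poly_def using assms
  by (intro sum.cong refl arg_cong2[where f="(*)"] prod.cong) auto

lemma edge_poly_affine:
  assumes "\<And>e. e \<in> E \<Longrightarrow> finite e"
  shows "edge_poly E a y
    = (1 - y v) * edge_poly E a (y(v := 0)) + y v * edge_poly E a (y(v := 1))"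
  unfolding edge_poly_def sum_distrib_left sum.distrib[symmetric]
proof (rule sum.cong[OF refl])
  fix e assume "e \<in> E"
  then have fin: "finite e" by (rule assms)
  have *: "(\<Prod>u\<in>e. (y(v := x)) u) = (if v \<in> e then x else 1) * (\<Prod>u\<in>e - {v}. y u)" for x
  proof -
    have "(\<Prod>u\<in>e - {v}. (y(v := x)) u) = (\<Prod>u\<in>e - {v}. y u)"
      by (intro prod.cong) auto
    then show ?thesis
      using prod.remove[OF fin, of v "y(v := x)"] by (cases "v \<in> e") simp_all
  qed
  have all: "(\<Prod>u\<in>e. y u) = (if v \<in> e then y v else 1) * (\<Prod>u\<in>e - {v}. y u)"
    using *[of "y v"] by (simp only: fun_upd_triv)
  have "a e * ((if v \<in> e then y v else 1) * P) = (1 - y v) * (a e * ((if v \<in> e then 0 else 1) * P))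
      + y v * (a e * ((if v \<in> e then 1 else 1) * P))" for P
    by (cases "v \<in> e") (simp_all add: algebra_simps)
  then show "a e * (\<Prod>u\<in>e. y u) = (1 - y v) * (a e * (\<Prod>u\<in>e. (y(v := 0)) u))
      + y v * (a e * (\<Prod>u\<in>e. (y(v := 1)) u))"
    by (simp only: all *)
qed

text \<open>A function that is affine in each variable separately takes its extreme values on a cube at the
  vertices. The variables are moved to 0 or 1 one at a time, by induction on a set \<open>S\<close> that contains
  those not yet there.\<close>

lemma edge_poly_bound_unit_cube:
  assumes "finite E" "finite V" "\<And>e. e \<in> E \<Longrightarrow> e \<subseteq> V"
    and M: "\<And>S. S \<subseteq> V \<Longrightarrow> \<bar>\<Sum>e | e \<in> E \<and> e \<subseteq> S. a e\<bar> \<le> M"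
    and y: "\<And>v. v \<in> V \<Longrightarrow> y v \<in> {0..1}"
  shows "\<bar>edge_poly E a y\<bar> \<le> M"
proof -
  have fin: "finite e" if "e \<in> E" for e
    using assms(2,3) that finite_subset by blast
  have "\<bar>edge_poly E a y\<bar> \<le> M"
    if "finite S" "\<And>v. v \<in> V \<Longrightarrow> y v \<in> {0..1}" "\<And>v. v \<in> V - S \<Longrightarrow> y v \<in> {0, 1}" for S y
    using that
  proof (induction S arbitrary: y)
    case empty
    have "edge_poly E a y = edge_poly E a (indicator {v \<in> V. y v = 1})"
      using empty.prems(2) by (intro edge_poly_cong[OF assms(3)]) (auto simp: indicator_def)
    then show ?case
      using M[of "{v \<in> V. y v = 1}"] by (simp add: edge_poly_indicator[OF assms(1) fin])
  next
    case (insert v S)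
    have corner: "\<bar>edge_poly E a (y(v := x))\<bar> \<le> M" if "x \<in> {0, 1}" for x
      using insert.prems that by (intro insert.IH) auto
    show ?case
    proof (cases "v \<in> V")
      case True
      then have yv: "0 \<le> y v" "y v \<le> 1" using insert.prems(1) by auto
      have "\<bar>edge_poly E a y\<bar> \<le> \<bar>(1 - y v) * edge_poly E a (y(v := 0))\<bar> + \<bar>y v * edge_poly E a (y(v := 1))\<bar>"
        by (subst edge_poly_affine[of E a y v]) (use fin abs_triangle_ineq in auto)
      also have "\<dots> = (1 - y v) * \<bar>edge_poly E a (y(v := 0))\<bar> + y v * \<bar>edge_poly E a (y(v := 1))\<bar>"
        using yv by (simp add: abs_mult)
      also have "\<dots> \<le> (1 - y v) * M + y v * M"
        using yv corner by (intro add_mono mult_left_mono) auto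
      finally show ?thesis by (simp add: algebra_simps)
    next
      case False
      then show ?thesis using insert.prems by (intro insert.IH) auto
    qed
  qed
  from this[OF assms(2) y] show ?thesis by auto
qed

text \<open>Write \<open>y = p - q\<close> with the positive and negative parts \<open>p\<close> and \<open>q\<close>. For \<open>t \<in> [0,1]\<close> the point
  \<open>p + t q\<close> lies in the unit cube, and \<open>y\<close> is the point of the same line at \<open>t = -1\<close>; so its value is
  controlled by the coefficients of a polynomial that is bounded on the unit interval.\<close>

lemma edge_poly_bound_symmetric_cube:
  "\<exists>K>0. \<forall>(V :: 'a set) E a M y.
    finite E \<longrightarrow> finite V \<longrightarrow> (\<forall>e\<in>E. e \<subseteq> V \<and> card e \<le> d) \<longrightarrow>
    (\<forall>S\<subseteq>V. \<bar>\<Sum>e | e \<in> E \<and> e \<subseteq> S. a e\<bar> \<le> M) \<longrightarrow>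
    (\<forall>v\<in>V. \<bar>y v\<bar> \<le> 1) \<longrightarrow> \<bar>edge_poly E a y\<bar> \<le> K * M"
proof -
  obtain K where K: "K > 0" "\<And>(p :: real poly) M k. degree p \<le> d \<Longrightarrow>
      (\<forall>t\<in>{0..1}. \<bar>poly p t\<bar> \<le> M) \<Longrightarrow> \<bar>coeff p k\<bar> \<le> K * M"
    using poly_coeff_bound_from_unit_interval[of d] by blast
  show ?thesis
  proof (intro exI[of _ "Suc d * K"] conjI allI impI)
    show "Suc d * K > 0" using K(1) by simp
  next
    fix V :: "'a set" and E :: "'a set set" and a :: "'a set \<Rightarrow> real" and M :: real and y :: "'a \<Rightarrow> real"
    assume E: "finite E" "finite V" "\<forall>e\<in>E. e \<subseteq> V \<and> card e \<le> d"
      and M: "\<forall>S\<subseteq>V. \<bar>\<Sum>e | e \<in> E \<and> e \<subseteq> S. a e\<bar> \<le> M"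
      and y: "\<forall>v\<in>V. \<bar>y v\<bar> \<le> 1"
    define p where "p = edge_poly_line E a (\<lambda>v. max (y v) 0) (\<lambda>v. max (- y v) 0)"
    have deg: "degree p \<le> d"
      unfolding p_def by (rule degree_edge_poly_line) (use E finite_subset in blast)+
    have "\<bar>poly p t\<bar> \<le> M" if "t \<in> {0..1}" for t
      unfolding p_def poly_edge_poly_line
    proof (rule edge_poly_bound_unit_cube[OF E(1,2)])
      fix v assume "v \<in> V"
      show "max (y v) 0 + t * max (- y v) 0 \<in> {0..1}"
      proof (cases "y v \<ge> 0")
        case False
        have "\<bar>y v\<bar> \<le> 1" using y \<open>v \<in> V\<close> by blast
        then have x: "0 \<le> - y v" "- y v \<le> 1" using False by linarith+
        have t: "0 \<le> t" "t \<le> 1" using that by simp_all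
        have "t * (- y v) \<le> 1" by (rule mult_le_one[OF t(2) x])
        moreover have "0 \<le> t * (- y v)" by (rule mult_nonneg_nonneg[OF t(1) x(1)])
        moreover have "max (y v) 0 = 0" "max (- y v) 0 = - y v" using False by linarith+
        ultimately show ?thesis by simp
      next
        case True
        have "\<bar>y v\<bar> \<le> 1" using y \<open>v \<in> V\<close> by blast
        then show ?thesis using True by simp
      qed
    qed (use E M in auto)
    then have coeff: "\<bar>coeff p k\<bar> \<le> K * M" for k
      using deg by (intro K(2)) auto
    have "M \<ge> 0" using M[rule_format, of "{}"] by simp
    have "edge_poly E a y = poly p (-1)"
      unfolding p_def poly_edge_poly_line by (intro arg_cong[where f="edge_poly E a"] ext) auto
    also have "\<bar>\<dots>\<bar> \<le> (\<Sum>k\<le>degree p. \<bar>coeff p k * (-1) ^ k\<bar>)"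
      unfolding poly_altdef by (rule sum_abs)
    also have "\<dots> \<le> (\<Sum>k\<le>degree p. K * M)"
      using coeff by (intro sum_mono) (simp add: abs_mult power_abs)
    also have "\<dots> \<le> Suc d * (K * M)"
      using deg K(1) \<open>M \<ge> 0\<close> by (simp add: mult_right_mono del: of_nat_Suc)
    finally show "\<bar>edge_poly E a y\<bar> \<le> Suc d * K * M" by (simp add: mult_ac)
  qed
qed

text \<open>An estimate of Bernstein type. The \<open>\<ell>\<^sub>1\<close> norm of the gradient at \<open>\<sigma>\<close> is the derivative in
  the direction of its own sign vector \<open>\<tau>\<close>, hence the linear coefficient on the line \<open>\<sigma> + t \<tau>\<close>.
  For \<open>t \<in> [0,1]\<close> this line stays in twice the symmetric cube, where homogeneity costs the factor
  \<open>2\<^sup>d\<close>.\<close>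

lemma edge_poly_gradient_bound:
  "\<exists>C>0. \<forall>(V :: 'a set) E a M \<sigma>.
    finite E \<longrightarrow> finite V \<longrightarrow> (\<forall>e\<in>E. e \<subseteq> V \<and> card e = d) \<longrightarrow>
    (\<forall>S\<subseteq>V. \<bar>\<Sum>e | e \<in> E \<and> e \<subseteq> S. a e\<bar> \<le> M) \<longrightarrow>
    (\<forall>v\<in>V. \<bar>\<sigma> v\<bar> \<le> 1) \<longrightarrow> (\<Sum>v\<in>V. \<bar>edge_poly_deriv E a v \<sigma>\<bar>) \<le> C * M"
proof -
  obtain K where K: "K > 0" "\<And>(p :: real poly) M k. degree p \<le> d \<Longrightarrow>
      (\<forall>t\<in>{0..1}. \<bar>poly p t\<bar> \<le> M) \<Longrightarrow> \<bar>coeff p k\<bar> \<le> K * M"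
    using poly_coeff_bound_from_unit_interval[of d] by blast
  obtain L where L: "L > 0" "\<And>(V :: 'a set) E a M y.
      finite E \<Longrightarrow> finite V \<Longrightarrow> (\<forall>e\<in>E. e \<subseteq> V \<and> card e \<le> d) \<Longrightarrow>
      (\<forall>S\<subseteq>V. \<bar>\<Sum>e | e \<in> E \<and> e \<subseteq> S. a e\<bar> \<le> M) \<Longrightarrow>
      (\<forall>v\<in>V. \<bar>y v\<bar> \<le> 1) \<Longrightarrow> \<bar>edge_poly E a y\<bar> \<le> L * M"
    using edge_poly_bound_symmetric_cube[of d, where 'a='a] by blast
  show ?thesis
  proof (intro exI[of _ "K * 2 ^ d * L"] conjI allI impI)
    show "K * 2 ^ d * L > 0" using K(1) L(1) by simp
  next
    fix V :: "'a set" and E :: "'a set set" and a :: "'a set \<Rightarrow> real" and M :: real and \<sigma> :: "'a \<Rightarrow> real"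
    assume E: "finite E" "finite V" "\<forall>e\<in>E. e \<subseteq> V \<and> card e = d"
      and M: "\<forall>S\<subseteq>V. \<bar>\<Sum>e | e \<in> E \<and> e \<subseteq> S. a e\<bar> \<le> M"
      and \<sigma>: "\<forall>v\<in>V. \<bar>\<sigma> v\<bar> \<le> 1"
    define \<tau> where "\<tau> v = sgn (edge_poly_deriv E a v \<sigma>)" for v
    define p where "p = edge_poly_line E a \<sigma> \<tau>"
    have deg: "degree p \<le> d"
      unfolding p_def
    proof (rule degree_edge_poly_line[OF E(1)])
      fix e assume "e \<in> E"
      then show "finite e" "card e \<le> d"
        using E(3) finite_subset[OF _ E(2)] by simp_all
    qed
    have "\<bar>poly p t\<bar> \<le> 2 ^ d * (L * M)" if t: "t \<in> {0..1}" for t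
    proof -
      define y where "y v = (\<sigma> v + t * \<tau> v) / 2" for v
      have "\<bar>y v\<bar> \<le> 1" if "v \<in> V" for v
      proof -
        have "\<bar>t * \<tau> v\<bar> \<le> 1"
          using t by (auto simp: \<tau>_def sgn_if)
        then show ?thesis using \<sigma> that unfolding y_def by fastforce
      qed
      then have "\<bar>edge_poly E a y\<bar> \<le> L * M"
        using E M by (intro L(2)[of E V]) auto
      moreover have "poly p t = 2 ^ d * edge_poly E a y"
        unfolding p_def poly_edge_poly_line edge_poly_def sum_distrib_left
      proof (rule sum.cong[OF refl])
        fix e assume "e \<in> E"
        then have "(\<Prod>v\<in>e. \<sigma> v + t * \<tau> v) = 2 ^ d * (\<Prod>v\<in>e. y v)"
          using E by (simp add: y_def prod_dividef)
        then show "a e * (\<Prod>v\<in>e. \<sigma> v + t * \<tau> v) = 2 ^ d * (a e * (\<Prod>v\<in>e. y v))"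
          by simp
      qed
      ultimately show ?thesis by (simp add: abs_mult)
    qed
    then have "\<bar>coeff p 1\<bar> \<le> K * (2 ^ d * (L * M))"
      using deg by (intro K(2)) auto
    moreover have "coeff p 1 = (\<Sum>v\<in>V. \<bar>edge_poly_deriv E a v \<sigma>\<bar>)"
      unfolding p_def using E
      by (subst coeff_1_edge_poly_line[OF E(1,2)]) (auto simp: \<tau>_def abs_sgn mult.commute)
    ultimately show "(\<Sum>v\<in>V. \<bar>edge_poly_deriv E a v \<sigma>\<bar>) \<le> K * 2 ^ d * L * M"
      by (simp add: mult_ac)
  qed
qed

section \<open>The lower bound\<close>

text \<open>At a sign vector, \<open>\<sigma> v\<close> times the partial derivative restores the missing factor of each monomial
  and leaves the absolute value unchanged. The result is a chaos indexed by the edges themselves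
  instead of the sets \<open>e - {v}\<close>.\<close>

lemma abs_edge_poly_deriv_sign:
  assumes "finite V" "\<And>e. e \<in> E \<Longrightarrow> e \<subseteq> V" "\<sigma> \<in> V \<rightarrow>\<^sub>E {-1, 1}" "v \<in> V"
  shows "\<bar>edge_poly_deriv E a v \<sigma>\<bar> = \<bar>walsh V (\<lambda>e. if e \<in> E \<and> v \<in> e then a e else 0) \<sigma>\<bar>"
proof -
  have sq: "\<bar>\<sigma> v\<bar> = 1" using assms(3,4) by (auto simp: PiE_iff)
  have "walsh V (\<lambda>e. if e \<in> E \<and> v \<in> e then a e else 0) \<sigma>
      = (\<Sum>e\<in>Pow V. if e \<in> E \<and> v \<in> e then a e * (\<Prod>u\<in>e. \<sigma> u) else 0)"
    unfolding walsh_def by (intro sum.cong) auto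
  also have "\<dots> = (\<Sum>e | e \<in> Pow V \<and> (e \<in> E \<and> v \<in> e). a e * (\<Prod>u\<in>e. \<sigma> u))"
    using assms(1) by (intro sum.inter_filter[symmetric]) auto
  also have "{e. e \<in> Pow V \<and> (e \<in> E \<and> v \<in> e)} = {e. e \<in> E \<and> v \<in> e}"
    using assms(2) by auto
  also have "(\<Sum>e | e \<in> E \<and> v \<in> e. a e * (\<Prod>u\<in>e. \<sigma> u)) = \<sigma> v * edge_poly_deriv E a v \<sigma>"
    unfolding edge_poly_deriv_def sum_distrib_left
  proof (rule sum.cong[OF refl])
    fix e assume "e \<in> {e. e \<in> E \<and> v \<in> e}"
    then have "finite e" "v \<in> e" using finite_subset[OF assms(2,1)] by auto
    then show "a e * (\<Prod>u\<in>e. \<sigma> u) = \<sigma> v * (a e * (\<Prod>u\<in>e - {v}. \<sigma> u))"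
      by (simp add: prod.remove)
  qed
  finally show ?thesis using sq by (simp add: abs_mult)
qed

text \<open>The lower bound for arbitrary signed weights: average the gradient bound over all sign vectors
  and bound each summand from below by the Khintchine inequality.\<close>

lemma degree_norm_sum_le_max_subset_sum:
  "\<exists>c>0. \<forall>(V :: 'a set) E a M.
    finite E \<longrightarrow> finite V \<longrightarrow> (\<forall>e\<in>E. e \<subseteq> V \<and> card e = d) \<longrightarrow>
    (\<forall>S\<subseteq>V. \<bar>\<Sum>e | e \<in> E \<and> e \<subseteq> S. a e\<bar> \<le> M) \<longrightarrow>
    c * (\<Sum>v\<in>V. degree_norm E a v) \<le> M"
proof -
  obtain C where C: "C > 0" "\<And>(V :: 'a set) E a M \<sigma>.
      finite E \<Longrightarrow> finite V \<Longrightarrow> (\<forall>e\<in>E. e \<subseteq> V \<and> card e = d) \<Longrightarrow>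
      (\<forall>S\<subseteq>V. \<bar>\<Sum>e | e \<in> E \<and> e \<subseteq> S. a e\<bar> \<le> M) \<Longrightarrow>
      (\<forall>v\<in>V. \<bar>\<sigma> v\<bar> \<le> 1) \<Longrightarrow> (\<Sum>v\<in>V. \<bar>edge_poly_deriv E a v \<sigma>\<bar>) \<le> C * M"
    using edge_poly_gradient_bound[of d, where 'a='a] by blast
  define h :: real where "h = 3 / 4 / 3 ^ d"
  show ?thesis
  proof (intro exI[of _ "h / C"] conjI allI impI)
    show "h / C > 0" using C(1) by (simp add: h_def)
  next
    fix V :: "'a set" and E :: "'a set set" and a :: "'a set \<Rightarrow> real" and M
    assume E: "finite E" "finite V" "\<forall>e\<in>E. e \<subseteq> V \<and> card e = d"
      and M: "\<forall>S\<subseteq>V. \<bar>\<Sum>e | e \<in> E \<and> e \<subseteq> S. a e\<bar> \<le> M"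
    have "h * degree_norm E a v \<le> sign_mean V (\<lambda>\<sigma>. \<bar>edge_poly_deriv E a v \<sigma>\<bar>)"
      if "v \<in> V" for v
    proof -
      let ?b = "\<lambda>e. if e \<in> E \<and> v \<in> e then a e else 0"
      have "(\<Sum>e\<in>Pow V. (?b e)\<^sup>2) = (\<Sum>e\<in>Pow V. if e \<in> E \<and> v \<in> e then (a e)\<^sup>2 else 0)"
        by (intro sum.cong) auto
      also have "\<dots> = (\<Sum>e | e \<in> Pow V \<and> (e \<in> E \<and> v \<in> e). (a e)\<^sup>2)"
        using E by (intro sum.inter_filter[symmetric]) auto
      also have "{e. e \<in> Pow V \<and> (e \<in> E \<and> v \<in> e)} = {e. e \<in> E \<and> v \<in> e}"
        using E by auto
      finally have "h * degree_norm E a v = h * sqrt (\<Sum>e\<in>Pow V. (?b e)\<^sup>2)"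
        by (simp add: degree_norm_def)
      also have "\<dots> \<le> sign_mean V (\<lambda>\<sigma>. \<bar>walsh V ?b \<sigma>\<bar>)"
        unfolding h_def using E by (intro walsh_Khintchine) auto
      also have "\<dots> = sign_mean V (\<lambda>\<sigma>. \<bar>edge_poly_deriv E a v \<sigma>\<bar>)"
        using E that by (intro sign_mean_cong abs_edge_poly_deriv_sign[symmetric]) auto
      finally show ?thesis .
    qed
    then have "h * (\<Sum>v\<in>V. degree_norm E a v) \<le> sign_mean V (\<lambda>\<sigma>. \<Sum>v\<in>V. \<bar>edge_poly_deriv E a v \<sigma>\<bar>)"
      unfolding sign_mean_sum sum_distrib_left by (rule sum_mono)
    also have "\<dots> \<le> sign_mean V (\<lambda>_. C * M)"
    proof (rule sign_mean_mono)
      fix \<sigma> assume \<sigma>: "\<sigma> \<in> V \<rightarrow>\<^sub>E {-1, 1::real}"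
      have "\<bar>\<sigma> v\<bar> \<le> 1" if "v \<in> V" for v
        using PiE_mem[OF \<sigma> that] by auto
      then show "(\<Sum>v\<in>V. \<bar>edge_poly_deriv E a v \<sigma>\<bar>) \<le> C * M"
        using E M by (intro C(2)) auto
    qed
    also have "\<dots> = C * M" by (rule sign_mean_const[OF E(2)])
    finally show "h / C * (\<Sum>v\<in>V. degree_norm E a v) \<le> M"
      using C(1) by (simp add: field_simps)
  qed
qed

section \<open>Maxima of Rademacher sums\<close>

text \<open>For \<open>x \<ge> 0\<close>, \<open>ln (cosh x)\<close> has derivative \<open>tanh x \<le> x\<close>.\<close>

lemma cosh_le_exp_half_square:
  fixes x :: real
  shows "cosh x \<le> exp (x\<^sup>2 / 2)"
proof -
  have tanh_le: "tanh y \<le> y" if "y \<ge> 0" for y :: real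
  proof -
    have "0 - tanh 0 \<le> y - tanh y"
    proof (rule DERIV_nonneg_imp_nondecreasing[OF that])
      fix z :: real
      have "((\<lambda>z. z - tanh z) has_real_derivative (1 - (1 - (tanh z)\<^sup>2))) (at z)"
        by (auto intro!: derivative_eq_intros simp: cosh_real_nonzero)
      then show "\<exists>D. ((\<lambda>z. z - tanh z) has_real_derivative D) (at z) \<and> 0 \<le> D"
        by (intro exI[of _ "1 - (1 - (tanh z)\<^sup>2)"]) auto
    qed
    then show ?thesis by simp
  qed
  have nonneg: "ln (cosh y) \<le> y\<^sup>2 / 2" if "y \<ge> 0" for y :: real
  proof -
    have "0\<^sup>2 / 2 - ln (cosh 0) \<le> y\<^sup>2 / 2 - ln (cosh y)"
    proof (rule DERIV_nonneg_imp_nondecreasing[OF that])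
      fix z :: real
      assume "0 \<le> z"
      have "((\<lambda>z. z\<^sup>2 / 2 - ln (cosh z)) has_real_derivative (z - tanh z)) (at z)"
        by (auto intro!: derivative_eq_intros simp: tanh_def cosh_real_pos)
      then show "\<exists>D. ((\<lambda>z. z\<^sup>2 / 2 - ln (cosh z)) has_real_derivative D) (at z) \<and> 0 \<le> D"
        using tanh_le[OF \<open>0 \<le> z\<close>] by (intro exI[of _ "z - tanh z"]) auto
    qed
    then show ?thesis by simp
  qed
  have "ln (cosh x) \<le> x\<^sup>2 / 2"
    using nonneg[of "\<bar>x\<bar>"] by (cases "x \<ge> 0") auto
  then show ?thesis
    by (metis cosh_real_pos exp_ln exp_le_cancel_iff)
qed

text \<open>Rademacher sums are sub-Gaussian: the moment generating function is a product of hyperbolic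
  cosines.\<close>

lemma sign_mean_exp_le:
  assumes "finite I"
  shows "sign_mean I (\<lambda>\<theta>. exp (\<Sum>i\<in>I. \<theta> i * c i)) \<le> exp ((\<Sum>i\<in>I. (c i)\<^sup>2) / 2)"
proof -
  have "sign_mean I (\<lambda>\<theta>. exp (\<Sum>i\<in>I. \<theta> i * c i)) = (\<Prod>i\<in>I. cosh (c i))"
    using assms sign_mean_prod[of I "\<lambda>i y. exp (y * c i)"]
    by (simp add: exp_sum cosh_field_def)
  also have "\<dots> \<le> (\<Prod>i\<in>I. exp ((c i)\<^sup>2 / 2))"
    by (intro prod_mono conjI cosh_le_exp_half_square) auto
  also have "\<dots> = exp ((\<Sum>i\<in>I. (c i)\<^sup>2) / 2)"
    using assms by (simp add: exp_sum sum_divide_distrib)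
  finally show ?thesis .
qed

text \<open>The union bound for sub-Gaussian variables. Bounding the maximum of \<open>exp (l \<bar>X\<bar>)\<close> by the sum over
  \<open>T\<close> and over both signs costs the factor \<open>2 * card T\<close>; the tangent of \<open>exp\<close> at \<open>a\<close>, the logarithm of the
  resulting estimate, takes the place of Jensen's inequality.\<close>

lemma sign_mean_Max_le:
  fixes c :: "'t \<Rightarrow> 'i \<Rightarrow> real"
  assumes "finite I" "finite T" "T \<noteq> {}" "l > 0"
    and var: "\<And>t. t \<in> T \<Longrightarrow> (\<Sum>i\<in>I. (c t i)\<^sup>2) \<le> s2"
  shows "sign_mean I (\<lambda>\<theta>. MAX t\<in>T. \<bar>\<Sum>i\<in>I. \<theta> i * c t i\<bar>) \<le> ln (2 * card T) / l + l * s2 / 2"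
proof -
  define X where "X t \<theta> = (\<Sum>i\<in>I. \<theta> i * c t i)" for t \<theta>
  define a where "a = ln (2 * card T) + l\<^sup>2 * s2 / 2"
  define R where "R \<theta> = a - 1 + exp (- a) * (\<Sum>t\<in>T. exp (l * X t \<theta>) + exp (- l * X t \<theta>))" for \<theta>
  have card: "card T > 0" using assms by (simp add: card_gt_0_iff)
  have "\<bar>X t \<theta>\<bar> \<le> R \<theta> / l" if "t \<in> T" for t \<theta>
  proof -
    have "l * \<bar>X t \<theta>\<bar> \<le> a - 1 + exp (l * \<bar>X t \<theta>\<bar> - a)"
      using exp_ge_add_one_self[of "l * \<bar>X t \<theta>\<bar> - a"] by linarith
    also have "\<dots> = a - 1 + exp (- a) * exp (l * \<bar>X t \<theta>\<bar>)"
      by (simp add: exp_diff exp_minus field_simps)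
    also have "exp (l * \<bar>X t \<theta>\<bar>) \<le> exp (l * X t \<theta>) + exp (- l * X t \<theta>)"
      by (cases "X t \<theta> \<ge> 0") auto
    also have "\<dots> \<le> (\<Sum>t\<in>T. exp (l * X t \<theta>) + exp (- l * X t \<theta>))"
      using assms(2) that
      by (intro member_le_sum[where f="\<lambda>t. exp (l * X t \<theta>) + exp (- l * X t \<theta>)"])
         (auto intro: add_nonneg_nonneg)
    finally show ?thesis
      using \<open>l > 0\<close> by (simp add: R_def field_simps)
  qed
  then have "(MAX t\<in>T. \<bar>X t \<theta>\<bar>) \<le> 1 / l * R \<theta>" for \<theta>
    using assms by (intro Max.boundedI) auto
  then have "sign_mean I (\<lambda>\<theta>. MAX t\<in>T. \<bar>X t \<theta>\<bar>) \<le> 1 / l * sign_mean I R"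
    unfolding sign_mean_cmult[symmetric] by (intro sign_mean_mono)
  also have "sign_mean I R \<le> a"
  proof -
    have mgf: "sign_mean I (\<lambda>\<theta>. exp (r * X t \<theta>)) \<le> exp (l\<^sup>2 * s2 / 2)"
      if "t \<in> T" "r\<^sup>2 = l\<^sup>2" for t r
    proof -
      have "sign_mean I (\<lambda>\<theta>. exp (r * X t \<theta>)) \<le> exp ((\<Sum>i\<in>I. (r * c t i)\<^sup>2) / 2)"
        using sign_mean_exp_le[OF assms(1), of "\<lambda>i. r * c t i"]
        by (simp add: X_def sum_distrib_left mult.left_commute)
      also have "\<dots> \<le> exp (l\<^sup>2 * s2 / 2)"
        using var[OF that(1)] that(2)
        by (simp add: power_mult_distrib sum_distrib_left[symmetric] mult_left_mono)
      finally show ?thesis .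
    qed
    have "sign_mean I R = a - 1 + exp (- a) *
        (\<Sum>t\<in>T. sign_mean I (\<lambda>\<theta>. exp (l * X t \<theta>)) + sign_mean I (\<lambda>\<theta>. exp (- l * X t \<theta>)))"
      unfolding R_def sign_mean_add sign_mean_cmult sign_mean_sum
      by (simp add: sign_mean_const[OF assms(1)])
    also have "\<dots> \<le> a - 1 + exp (- a) * (\<Sum>t\<in>T. exp (l\<^sup>2 * s2 / 2) + exp (l\<^sup>2 * s2 / 2))"
      by (intro add_left_mono mult_left_mono sum_mono add_mono mgf) auto
    also have "\<dots> = a"
    proof -
      have "exp a = 2 * card T * exp (l\<^sup>2 * s2 / 2)"
        unfolding a_def exp_add using card by simp
      then have "exp (- a) * (2 * card T * exp (l\<^sup>2 * s2 / 2)) = 1"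
        by (metis exp_minus_inverse mult.commute)
      then show ?thesis by (simp add: mult_ac)
    qed
    finally show ?thesis .
  qed
  finally have "sign_mean I (\<lambda>\<theta>. MAX t\<in>T. \<bar>X t \<theta>\<bar>) \<le> 1 / l * a"
    using \<open>l > 0\<close> by (simp add: mult_left_mono divide_right_mono)
  also have "1 / l * a = ln (2 * card T) / l + l * s2 / 2"
    using \<open>l > 0\<close> by (simp add: a_def field_simps power2_eq_square)
  finally show ?thesis unfolding X_def .
qed

lemma exists_top_subset:
  fixes f :: "'a \<Rightarrow> real"
  assumes "finite U" "k \<le> card U"
  shows "\<exists>T\<subseteq>U. card T = k \<and> (\<forall>x\<in>T. \<forall>y\<in>U - T. f y \<le> f x)"
  using assms(2)
proof (induction k)
  case 0
  show ?case by (intro exI[of _ "{}"]) auto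
next
  case (Suc k)
  then obtain T where T: "T \<subseteq> U" "card T = k" "\<forall>x\<in>T. \<forall>y\<in>U - T. f y \<le> f x"
    by auto
  have fin: "finite T" "finite (U - T)" using T(1) assms(1) finite_subset by auto
  have "U - T \<noteq> {}"
    using T Suc.prems card_mono[OF fin(1), of U] by auto
  then have "Max (f ` (U - T)) \<in> f ` (U - T)"
    using fin by (intro Max_in) auto
  then obtain z where "z \<in> U - T" "f z = Max (f ` (U - T))"
    by auto
  then have z: "z \<in> U - T" "\<forall>y\<in>U - T. f y \<le> f z"
    using fin by auto
  show ?case
    using T z fin by (intro exI[of _ "insert z T"]) auto
qed

section \<open>The upper bound\<close>

lemma sum_square_meeting_le:
  assumes "finite E" "finite L"
  shows "(\<Sum>e | e \<in> E \<and> e \<inter> L \<noteq> {}. (w e)\<^sup>2) \<le> (\<Sum>v\<in>L. (degree_norm E w v)\<^sup>2)"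
proof -
  have "(\<Sum>e | e \<in> E \<and> e \<inter> L \<noteq> {}. (w e)\<^sup>2)
      \<le> (\<Sum>e\<in>E. \<Sum>v\<in>L. if v \<in> e then (w e)\<^sup>2 else 0)"
    unfolding sum.inter_filter[OF assms(1)]
  proof (rule sum_mono)
    fix e
    show "(if e \<inter> L \<noteq> {} then (w e)\<^sup>2 else 0) \<le> (\<Sum>v\<in>L. if v \<in> e then (w e)\<^sup>2 else 0)"
    proof (cases "e \<inter> L = {}")
      case False
      then obtain v where v: "v \<in> e" "v \<in> L" by auto
      then show ?thesis
        using member_le_sum[of v L "\<lambda>v. if v \<in> e then (w e)\<^sup>2 else 0"] assms(2) by auto
    qed (auto intro: sum_nonneg)
  qed
  also have "\<dots> = (\<Sum>v\<in>L. (degree_norm E w v)\<^sup>2)"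
    unfolding degree_norm_square sum.inter_filter[OF assms(1)] by (rule sum.swap)
  finally show ?thesis .
qed

text \<open>The edges inside \<open>V'\<close> either lie in \<open>V' \<inter> T\<close> or meet \<open>U - T\<close>. The second kind is selected by
  zero weights, so that the sum runs over all of \<open>E\<close> and is a Rademacher sum in the full coloring.\<close>

lemma max_imbalance_le_add_meeting:
  assumes "finite U" "finite E" "T \<subseteq> U"
  shows "max_imbalance U E w \<theta> \<le> max_imbalance T E w \<theta>
    + (MAX V'\<in>Pow U. \<bar>\<Sum>e\<in>E. \<theta> e * (if e \<subseteq> V' \<and> e \<inter> (U - T) \<noteq> {} then w e else 0)\<bar>)"
    (is "_ \<le> _ + ?M")
proof -
  have fin: "finite (Pow U)" "finite (Pow T)" using assms finite_subset by auto
  have "\<bar>\<Sum>e | e \<in> E \<and> e \<subseteq> V'. \<theta> e * w e\<bar> \<le> max_imbalance T E w \<theta> + ?M" if "V' \<in> Pow U" for V'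
  proof -
    let ?h = "\<lambda>e. if e \<subseteq> V' \<and> e \<inter> (U - T) \<noteq> {} then w e else 0"
    have split: "(\<Sum>e | e \<in> E \<and> e \<subseteq> V'. \<theta> e * w e)
        = (\<Sum>e | e \<in> E \<and> e \<subseteq> V' \<inter> T. \<theta> e * w e) + (\<Sum>e\<in>E. \<theta> e * ?h e)"
      unfolding sum.inter_filter[OF assms(2)] sum.distrib[symmetric]
      using that by (intro sum.cong refl) auto
    have "\<bar>\<Sum>e | e \<in> E \<and> e \<subseteq> V' \<inter> T. \<theta> e * w e\<bar> \<le> max_imbalance T E w \<theta>"
      unfolding max_imbalance_def using fin by (intro Max_ge finite_imageI imageI) auto
    moreover have "\<bar>\<Sum>e\<in>E. \<theta> e * ?h e\<bar> \<le> ?M"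
      using fin that by (intro Max_ge) auto
    ultimately show ?thesis unfolding split by linarith
  qed
  then show ?thesis
    unfolding max_imbalance_def[of U] using fin by (intro Max.boundedI) auto
qed

text \<open>The union bound over the subsets of \<open>U\<close>, at the optimal scale \<open>1 / \<mu>\<close> up to constants. The squared
  weights add up to at most \<open>card U * \<mu>\<^sup>2\<close> since every edge counted meets \<open>L\<close>. The final numerical
  step is where \<open>card U \<ge> 2\<close> enters.\<close>

lemma sign_mean_max_meeting_le:
  fixes \<mu> :: real
  assumes "finite U" "finite E" "card U \<ge> 2" "L \<subseteq> U"
    and "\<And>v. v \<in> L \<Longrightarrow> degree_norm E w v \<le> \<mu>" "\<mu> \<ge> 0"
  shows "sign_mean E (\<lambda>\<theta>. MAX V'\<in>Pow U.
      \<bar>\<Sum>e\<in>E. \<theta> e * (if e \<subseteq> V' \<and> e \<inter> L \<noteq> {} then w e else 0)\<bar>) \<le> 2 * card U * \<mu>"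
proof -
  let ?c = "\<lambda>V' e. if e \<subseteq> V' \<and> e \<inter> L \<noteq> {} then w e else 0"
  let ?m = "real (card U)"
  have fin: "finite L" "finite (Pow U)" using assms finite_subset by auto
  have "(\<Sum>e\<in>E. (?c V' e)\<^sup>2) \<le> ?m * \<mu>\<^sup>2" for V'
  proof -
    have "(\<Sum>e\<in>E. (?c V' e)\<^sup>2) \<le> (\<Sum>e | e \<in> E \<and> e \<inter> L \<noteq> {}. (w e)\<^sup>2)"
      unfolding sum.inter_filter[OF assms(2)] by (intro sum_mono) auto
    also have "\<dots> \<le> (\<Sum>v\<in>L. (degree_norm E w v)\<^sup>2)"
      by (rule sum_square_meeting_le) (use assms fin in auto)
    also have "\<dots> \<le> (\<Sum>v\<in>L. (\<mu>::real)\<^sup>2)"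
      using assms(5) by (intro sum_mono power_mono degree_norm_nonneg)
    also have "\<dots> \<le> ?m * \<mu>\<^sup>2"
      using card_mono[OF assms(1,4)] by (simp add: mult_right_mono)
    finally show ?thesis .
  qed
  note var = this
  show ?thesis
  proof (cases "\<mu> = 0")
    \<comment> \<open>The scale \<open>1 / \<mu>\<close> is not available, but then all weights involved vanish.\<close>
    case True
    have "?c V' e = 0" if "e \<in> E" for V' e
      using sum_nonneg_eq_0_iff[OF assms(2), of "\<lambda>e. (?c V' e)\<^sup>2"] var[of V'] that True
        sum_nonneg[of E "\<lambda>e. (?c V' e)\<^sup>2"] by auto
    then have "(\<Sum>e\<in>E. \<theta> e * ?c V' e) = 0" for \<theta> V'
      by (intro sum.neutral) simp
    then have "(MAX V'\<in>Pow U. \<bar>\<Sum>e\<in>E. \<theta> e * ?c V' e\<bar>) = 0" for \<theta>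
      by (simp add: image_constant_conv Pow_not_empty)
    then show ?thesis
      using True by (simp add: sign_mean_const[OF assms(2)])
  next
    case False
    then have "\<mu> > 0" using assms(6) by simp
    then have "sign_mean E (\<lambda>\<theta>. MAX V'\<in>Pow U. \<bar>\<Sum>e\<in>E. \<theta> e * ?c V' e\<bar>)
        \<le> ln (2 * card (Pow U)) / (1 / \<mu>) + 1 / \<mu> * (?m * \<mu>\<^sup>2) / 2"
      using var fin by (intro sign_mean_Max_le[OF assms(2)]) auto
    also have "\<dots> = \<mu> * (ln (2 ^ Suc (card U)) + ?m / 2)"
      using False by (simp add: card_Pow[OF assms(1)] field_simps power2_eq_square)
    also have "\<dots> \<le> \<mu> * (2 * ?m)"
    proof (rule mult_left_mono)
      have "ln ((2::real) ^ Suc (card U)) = Suc (card U) * ln 2"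
        by (rule ln_realpow)
      also have "\<dots> \<le> real (Suc (card U)) * 1"
        using ln_le_minus_one[of "2::real"] by (intro mult_left_mono) auto
      finally show "ln (2 ^ Suc (card U)) + ?m / 2 \<le> 2 * ?m"
        using assms(3) by simp
    qed (use assms in simp)
    finally show ?thesis by (simp add: mult_ac)
  qed
qed

text \<open>The bound uses only the degree norms on the top half \<open>T\<close>. This is what makes the induction close:
  the bound for \<open>T\<close> uses only its own top half \<open>T'\<close>, and leaves \<open>T - T'\<close> free to pay for the edges that
  leave \<open>T\<close>. That layer has at least an eighth of the vertices of \<open>U\<close>, each with degree norm at least
  the minimum \<open>\<mu>\<close> over \<open>T\<close>.\<close>

lemma sign_mean_max_imbalance_le_top_half:
  fixes E :: "'a set set"
  assumes "finite E" "\<And>e. e \<in> E \<Longrightarrow> card e \<ge> 2"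
    and "finite U" "T \<subseteq> U" "card T = card U div 2"
    and "\<forall>x\<in>T. \<forall>y\<in>U - T. degree_norm E w y \<le> degree_norm E w x"
  shows "sign_mean E (max_imbalance U E w) \<le> 16 * (\<Sum>v\<in>T. degree_norm E w v)"
  using assms(3-)
proof (induction "card U" arbitrary: U T rule: less_induct)
  case less
  let ?\<sigma> = "degree_norm E w"
  show ?case
  proof (cases "card U \<ge> 2")
    \<comment> \<open>With fewer than two vertices there are no edges, and \<open>T\<close> is empty.\<close>
    case False
    have no_edge: "{e \<in> E. e \<subseteq> V'} = {}" if "V' \<subseteq> U" for V'
    proof -
      have "\<not> e \<subseteq> V'" if "e \<in> E" for e
      proof
        assume "e \<subseteq> V'"
        then have "card e \<le> card U"
          using \<open>V' \<subseteq> U\<close> less.prems(1) by (intro card_mono) auto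
        then show False
          using assms(2)[OF that] False by linarith
      qed
      then show ?thesis by auto
    qed
    have "max_imbalance U E w \<theta> = (MAX V'\<in>Pow U. 0)" for \<theta>
      unfolding max_imbalance_def using no_edge
      by (intro arg_cong[where f=Max] image_cong refl) (simp only: PowD sum.empty abs_zero)
    then have "sign_mean E (max_imbalance U E w) = sign_mean E (\<lambda>_. 0)"
      by (intro sign_mean_cong) (simp add: image_constant_conv Pow_not_empty)
    then show ?thesis
      by (simp add: sign_mean_const[OF assms(1)] sum_nonneg degree_norm_nonneg)
  next
    case True
    have finT: "finite T" by (rule finite_subset[OF less.prems(2,1)])
    obtain T' where T': "T' \<subseteq> T" "card T' = card T div 2"
        "\<forall>x\<in>T'. \<forall>y\<in>T - T'. ?\<sigma> y \<le> ?\<sigma> x"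
      using exists_top_subset[OF finT, of "card T div 2" ?\<sigma>] by auto
    have IH: "sign_mean E (max_imbalance T E w) \<le> 16 * (\<Sum>v\<in>T'. ?\<sigma> v)"
      using True less.prems T' finT by (intro less.hyps) auto
    have "T \<noteq> {}" using True less.prems(3) by auto
    define \<mu> where "\<mu> = Min (?\<sigma> ` T)"
    have \<mu>_le: "\<mu> \<le> ?\<sigma> x" if "x \<in> T" for x
      unfolding \<mu>_def using that finT by auto
    have "\<mu> \<in> ?\<sigma> ` T" unfolding \<mu>_def using finT \<open>T \<noteq> {}\<close> by (intro Min_in) auto
    then obtain z where z: "z \<in> T" "\<mu> = ?\<sigma> z" by auto
    have "\<mu> \<ge> 0" using z degree_norm_nonneg by auto
    have low: "?\<sigma> v \<le> \<mu>" if "v \<in> U - T" for v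
      using that z less.prems(4) by auto
    have "sign_mean E (max_imbalance U E w) \<le> sign_mean E (max_imbalance T E w) +
        sign_mean E (\<lambda>\<theta>. MAX V'\<in>Pow U.
          \<bar>\<Sum>e\<in>E. \<theta> e * (if e \<subseteq> V' \<and> e \<inter> (U - T) \<noteq> {} then w e else 0)\<bar>)"
      unfolding sign_mean_add[symmetric]
      by (intro sign_mean_mono max_imbalance_le_add_meeting less.prems assms)
    also have "\<dots> \<le> 16 * (\<Sum>v\<in>T'. ?\<sigma> v) + 2 * card U * \<mu>"
      using True less.prems low \<open>\<mu> \<ge> 0\<close> assms(1)
      by (intro add_mono IH sign_mean_max_meeting_le) auto
    also have "2 * card U * \<mu> \<le> 16 * (card (T - T') * \<mu>)"
    proof -
      have "card (T - T') = card T - card T div 2"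
        using T' finT by (simp add: card_Diff_subset finite_subset)
      then have "card U \<le> 8 * card (T - T')"
        using True less.prems(3) by simp
      then have "real (2 * card U) \<le> 16 * real (card (T - T'))" by linarith
      from mult_right_mono[OF this \<open>\<mu> \<ge> 0\<close>] show ?thesis by (simp add: mult_ac)
    qed
    also have "card (T - T') * \<mu> \<le> (\<Sum>v\<in>T - T'. ?\<sigma> v)"
      using sum_mono[of "T - T'" "\<lambda>_. \<mu>" ?\<sigma>] \<mu>_le by simp
    also have "16 * (\<Sum>v\<in>T'. ?\<sigma> v) + 16 * (\<Sum>v\<in>T - T'. ?\<sigma> v) = 16 * (\<Sum>v\<in>T. ?\<sigma> v)"
      using sum.subset_diff[OF T'(1) finT, of ?\<sigma>] by simp
    finally show ?thesis by simp
  qed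
qed

lemma sign_mean_max_imbalance_le:
  assumes "finite E" "\<And>e. e \<in> E \<Longrightarrow> card e \<ge> 2" "finite V"
  shows "sign_mean E (max_imbalance V E w) \<le> 16 * (\<Sum>v\<in>V. degree_norm E w v)"
proof -
  obtain T where T: "T \<subseteq> V" "card T = card V div 2"
      "\<forall>x\<in>T. \<forall>y\<in>V - T. degree_norm E w y \<le> degree_norm E w x"
    using exists_top_subset[OF assms(3), of "card V div 2" "degree_norm E w"] by auto
  have "sign_mean E (max_imbalance V E w) \<le> 16 * (\<Sum>v\<in>T. degree_norm E w v)"
    by (rule sign_mean_max_imbalance_le_top_half) (use assms T in auto)
  also have "\<dots> \<le> 16 * (\<Sum>v\<in>V. degree_norm E w v)"
    using assms(3) T(1) by (intro mult_left_mono sum_mono2 degree_norm_nonneg) auto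
  finally show ?thesis .
qed

section \<open>Discrepancy\<close>

lemma coloring_expectation_eq_sign_mean:
  "finite E \<Longrightarrow> coloring_expectation E F = sign_mean E F"
  by (simp add: coloring_expectation_def sign_mean_def colorings_def card_signs)

lemma finite_colorings: "finite E \<Longrightarrow> finite (colorings E)"
  by (simp add: colorings_def finite_signs)

lemma colorings_nonempty: "colorings E \<noteq> {}"
  by (simp add: colorings_def PiE_eq_empty_iff)

lemma disc_le_coloring_expectation:
  assumes "finite E"
  shows "disc V E w \<le> coloring_expectation E (max_imbalance V E w)"
proof -
  have "disc V E w = sign_mean E (\<lambda>_. disc V E w)"
    by (simp add: sign_mean_const[OF assms])
  also have "\<dots> \<le> sign_mean E (max_imbalance V E w)"
    using finite_colorings[OF assms]
    by (intro sign_mean_mono) (auto simp: disc_def colorings_def)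
  finally show ?thesis by (simp add: coloring_expectation_eq_sign_mean[OF assms])
qed

lemma degree_norm_coloring:
  assumes "\<theta> \<in> colorings E"
  shows "degree_norm E (\<lambda>e. \<theta> e * w e) v = degree_norm E w v"
proof -
  have "(\<theta> e)\<^sup>2 = 1" if "e \<in> E" for e
    using PiE_mem[OF assms[unfolded colorings_def] that] by auto
  then show ?thesis
    by (auto simp: degree_norm_def power_mult_distrib intro!: sum.cong)
qed

theorem theorem8:
  fixes d :: nat
  assumes "d \<ge> 2"
  shows "\<exists>c C :: real. c > 0 \<and> C > 0 \<and>
    (\<forall>n\<ge>d. \<forall>(V :: nat set) (w :: nat set \<Rightarrow> real). finite V \<and> card V = n \<longrightarrow>
      (let E = complete_edges V d in
        c * degree_norm_sum V E w \<le> disc V E w \<and>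
        disc V E w \<le> coloring_expectation E (max_imbalance V E w) \<and>
        coloring_expectation E (max_imbalance V E w) \<le> C * degree_norm_sum V E w))"
proof -
  obtain c where c: "c > 0" "\<And>(V :: nat set) E a M.
      finite E \<Longrightarrow> finite V \<Longrightarrow> (\<forall>e\<in>E. e \<subseteq> V \<and> card e = d) \<Longrightarrow>
      (\<forall>S\<subseteq>V. \<bar>\<Sum>e | e \<in> E \<and> e \<subseteq> S. a e\<bar> \<le> M) \<Longrightarrow>
      c * (\<Sum>v\<in>V. degree_norm E a v) \<le> M"
    using degree_norm_sum_le_max_subset_sum[of d, where 'a=nat] by blast
  have "c * degree_norm_sum V E w \<le> disc V E w"
    and "disc V E w \<le> coloring_expectation E (max_imbalance V E w)"
    and "coloring_expectation E (max_imbalance V E w) \<le> 16 * degree_norm_sum V E w"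
    if V: "finite V" and E_def: "E = complete_edges V d" for V :: "nat set" and E w
  proof -
    have E: "\<forall>e\<in>E. e \<subseteq> V \<and> card e = d"
      by (auto simp: E_def complete_edges_def)
    then have finE: "finite E"
      using V by (intro finite_subset[of E "Pow V"]) auto
    have dns: "degree_norm_sum V E w = (\<Sum>v\<in>V. degree_norm E w v)"
      by (simp add: degree_norm_sum_def degree_norm_def)
    have "c * degree_norm_sum V E w \<le> max_imbalance V E w \<theta>" if \<theta>: "\<theta> \<in> colorings E" for \<theta>
    proof -
      have "\<forall>S\<subseteq>V. \<bar>\<Sum>e | e \<in> E \<and> e \<subseteq> S. \<theta> e * w e\<bar> \<le> max_imbalance V E w \<theta>"
        unfolding max_imbalance_def using V by (intro allI impI Max_ge) auto
      then have "c * (\<Sum>v\<in>V. degree_norm E (\<lambda>e. \<theta> e * w e) v) \<le> max_imbalance V E w \<theta>"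
        by (rule c(2)[OF finE V E])
      then show ?thesis
        by (simp add: dns degree_norm_coloring[OF \<theta>])
    qed
    then show "c * degree_norm_sum V E w \<le> disc V E w"
      unfolding disc_def using finite_colorings[OF finE] colorings_nonempty
      by (intro Min.boundedI) auto
    show "disc V E w \<le> coloring_expectation E (max_imbalance V E w)"
      by (rule disc_le_coloring_expectation[OF finE])
    show "coloring_expectation E (max_imbalance V E w) \<le> 16 * degree_norm_sum V E w"
      unfolding coloring_expectation_eq_sign_mean[OF finE] dns
      using E assms by (intro sign_mean_max_imbalance_le finE V) auto
  qed
  then show ?thesis
    using c(1) by (intro exI[of _ c] exI[of _ 16]) (auto simp: Let_def)
qed

end
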